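(* Let $T_t=\sum_{i=0}^m\mathfrak T_it^i$ be an order $m$ deformation of a relative Rota-Baxter operator $T$ on an $n$-LieRep pair $(\mathfrak g,[-,\cdots,-]_{\mathfrak g};\rho)$. Then $T_t$ is extendable if and only if the cohomology class $[\Theta_m]\in\mathcal H^2(V,\mathfrak g)$ is trivial, where $$\Theta_m(u_1,\cdots,u_n)=\sum_{\substack{i_1+\cdots+i_n=m+1\\0\le i_1,\cdots,i_n\le m}}\Big([\mathfrak T_{i_1}u_1,\cdots,\mathfrak T_{i_n}u_n]_{\mathfrak g}-\mathfrak T_{i_1}\big(\sum_{k=1}^n(-1)^{n-k}\rho(\mathfrak T_{i_2}u_1,\cdots,\mathfrak T_{i_k}u_{k-1},\mathfrak T_{i_{k+1}}u_{k+1},\cdots,\mathfrak T_{i_n}u_n)(u_k)\big)\Big).$$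
   Context: All vector spaces are finite dimensional over an algebraically closed field $\mathbb K$ of characteristic $0$; $n\ge2$; a hat denotes omission. An $n$-Lie algebra is a vector space $\mathfrak g$ with a skew-symmetric linear map $[-,\cdots,-]_{\mathfrak g}:\wedge^n\mathfrak g\to\mathfrak g$ such that $[x_1,\cdots,x_{n-1},[y_1,\cdots,y_n]]=\sum_{i=1}^n[y_1,\cdots,y_{i-1},[x_1,\cdots,x_{n-1},y_i],y_{i+1},\cdots,y_n]$. For $\mathfrak X=x_1\wedge\cdots\wedge x_{n-1}$, $\mathfrak Y=y_1\wedge\cdots\wedge y_{n-1}$ write $[\mathfrak X,y]_{\mathfrak g}=[x_1,\cdots,x_{n-1},y]_{\mathfrak g}$ and $\mathfrak X\circ\mathfrak Y=\sum_{i=1}^{n-1}y_1\wedge\cdots\wedge[\mathfrak X,y_i]_{\mathfrak g}\wedge\cdots\wedge y_{n-1}$ (and similarly in any $n$-Lie algebra). A representation on $V$ is a linear map $\rho:\wedge^{n-1}\mathfrak g\to\mathfrak{gl}(V)$ with $[\rho(\mathfrak X),\rho(\mathfrak Y)]=\rho(\mathfrak X\circ\mathfrak Y)$ and $\rho(x_1,\cdots,x_{n-2},[y_1,\cdots,y_n]_{\mathfrak g})=\sum_{i=1}^n(-1)^{n-i}\rho(y_1,\cdots,\widehat{y_i},\cdots,y_n)\rho(x_1,\cdots,x_{n-2},y_i)$. An $n$-LieRep pair is an $n$-Lie algebra with a representation $\rho$ on a vector space $V$. A relative Rota-Baxter operator on it is a linear map $T:V\to\mathfrak g$ with $[Tv_1,\cdots,Tv_n]_{\mathfrak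 g}=\sum_{i=1}^n(-1)^{n-i}T(\rho(Tv_1,\cdots,\widehat{Tv_i},\cdots,Tv_n)(v_i))$. An order $m$ deformation of $T$ is a sequence of linear maps $\mathfrak T_i:V\to\mathfrak g$, $0\le i\le m$, with $\mathfrak T_0=T$, such that the $\mathbb K[t]/(t^{m+1})$-module map $T_t=\sum_{i=0}^m\mathfrak T_it^i:V[t]/(t^{m+1})\to\mathfrak g[t]/(t^{m+1})$ satisfies $[T_tu_1,\cdots,T_tu_n]_{\mathfrak g}=T_t\big(\sum_{i=1}^n(-1)^{n-i}\rho(T_tu_1,\cdots,\widehat{T_tu_i},\cdots,T_tu_n)(u_i)\big)$ for all $u_i\in V$ (bracket and $\rho$ extended $\mathbb K[t]/(t^{m+1})$-multilinearly). It is extendable if there is a linear map $\mathfrak T_{m+1}:V\to\mathfrak g$ such that $T_t+\mathfrak T_{m+1}t^{m+1}$ is an order $m+1$ deformation of $T$. Cohomology of $T$: $V$ is an $n$-Lie algebra under $[u_1,\cdots,u_n]_T=\sum_{i=1}^n(-1)^{n-i}\rho(Tu_1,\cdots,\widehat{Tu_i},\cdots,Tu_n)(u_i)$ (the operations $\circ$ and $[\mathfrak U,u]_T$ below refer to it), and $\rho_T(u_1,\cdots,u_{n-1})x=[Tu_1,\cdots,Tu_{n-1},x]_{\mathfrak g}-\sum_{i=1}^{n-1}(-1)^{n-i}T\rho(Tu_1,\cdots,\widehat{Tu_i},\cdots,Tu_{n-1},x)(u_i)$ is a representation of it on $\mathfrak g$. For $m\ge1$ let $C_T^m(V;\mathfrak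 g)=\mathrm{Hom}(\otimes^{m-1}(\wedge^{n-1}V)\wedge V,\mathfrak g)$, where $\otimes^{p}(\wedge^{n-1}V)\wedge V$ means $V$ for $p=0$ and $\otimes^{p-1}(\wedge^{n-1}V)\otimes\wedge^nV$ for $p\ge1$; $C^0_T(V;\mathfrak g)=\wedge^{n-1}\mathfrak g$. The differential $d:C_T^m\to C_T^{m+1}$ is, for $m=0$, $(d\mathfrak X)(v)=T\rho(\mathfrak X)v-[\mathfrak X,Tv]_{\mathfrak g}$, and for $m\ge1$, with $\mathfrak U_i=u_i^1\wedge\cdots\wedge u_i^{n-1}$, $$(df)(\mathfrak U_1,\cdots,\mathfrak U_m,u)=\sum_{1\le j<k\le m}(-1)^jf(\mathfrak U_1,\cdots,\widehat{\mathfrak U_j},\cdots,\mathfrak U_{k-1},\mathfrak U_j\circ\mathfrak U_k,\mathfrak U_{k+1},\cdots,\mathfrak U_m,u)+\sum_{j=1}^m(-1)^jf(\mathfrak U_1,\cdots,\widehat{\mathfrak U_j},\cdots,\mathfrak U_m,[\mathfrak U_j,u]_T)$$ $$+\sum_{j=1}^m(-1)^{j+1}\rho_T(\mathfrak U_j)f(\mathfrak U_1,\cdots,\widehat{\mathfrak U_j},\cdots,\mathfrak U_m,u)+\sum_{i=1}^{n-1}(-1)^{n+m-i+1}\rho_T(u_m^1,\cdots,\widehat{u_m^i},\cdots,u_m^{n-1},u)f(\mathfrak U_1,\cdots,\mathfrak U_{m-1},u_m^i).$$ $\mathcal H^m(V,\mathfrak g)$ is the $m$-th cohomology group of $(C_T^*(V;\mathfrak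 g),d)$. The cochain $\Theta_m\in C_T^2(V;\mathfrak g)=\mathrm{Hom}(\wedge^nV,\mathfrak g)$ of the claim is a $2$-cocycle, so $[\Theta_m]$ is defined. *)

theory Defs
  imports
    "HOL-Computational_Algebra.Polynomial"
    "HOL-Algebra.Coset"
begin

text \<open>
  Conventions. An \<open>n\<close>-ary operation is a function on lists, of which only the values on lists of
  length \<open>n\<close> matter. A linear map out of an exterior power \<open>\<Wedge>\<^sup>n V\<close> is represented by the corresponding
  alternating multilinear function, so that a decomposable \<open>x\<^sub>1 \<and> \<dots> \<and> x\<^sub>n\<close> becomes the list
  \<open>[x\<^sub>1, \<dots>, x\<^sub>n]\<close>, and identities between maps on exterior powers are stated on decomposables.
  List positions start at 0, so the 1-based index \<open>i\<close> is the position \<open>i - 1\<close> and the sign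
  \<open>(-1)\<^bsup>n-i\<^esup>\<close> appears as \<open>signed (n - Suc i)\<close>.
\<close>

definition finite_dim :: "('k::field \<Rightarrow> 'a::ab_group_add \<Rightarrow> 'a) \<Rightarrow> bool" where
  "finite_dim s \<longleftrightarrow> (\<exists>B. finite_dimensional_vector_space s B)"

text \<open>\<open>signed k x\<close> is \<open>(-1)\<^sup>k x\<close>.\<close>

definition signed :: "nat \<Rightarrow> 'a::ab_group_add \<Rightarrow> 'a" where
  "signed k x = (if even k then x else - x)"

definition omit :: "nat \<Rightarrow> 'a list \<Rightarrow> 'a list" where
  "omit i xs = take i xs @ drop (Suc i) xs"

definition alternating_multilinear ::
  "nat \<Rightarrow> ('k::field \<Rightarrow> 'a::ab_group_add \<Rightarrow> 'a) \<Rightarrow> ('k \<Rightarrow> 'b::ab_group_add \<Rightarrow> 'b) \<Rightarrow> ('a list \<Rightarrow> 'b) \<Rightarrow> bool"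
where
  "alternating_multilinear n s1 s2 \<phi> \<longleftrightarrow>
     (\<forall>xs i. length xs = n \<and> i < n \<longrightarrow> Vector_Spaces.linear s1 s2 (\<lambda>x. \<phi> (xs[i := x]))) \<and>
     (\<forall>xs i j. length xs = n \<and> i < n \<and> j < n \<and> i \<noteq> j \<and> xs ! i = xs ! j \<longrightarrow> \<phi> xs = 0)"

locale n_Lie_algebra =
  fixes n :: nat
    and sg :: "'k::{alg_closed_field, field_char_0} \<Rightarrow> 'g::ab_group_add \<Rightarrow> 'g"
    and br :: "'g list \<Rightarrow> 'g"
  assumes n_ge_2: "n \<ge> 2"
    and finite_dim_g: "finite_dim sg"
    and br_alternating: "alternating_multilinear n sg sg br"
    and fundamental_identity:
      "length xs = n - 1 \<Longrightarrow> length ys = n \<Longrightarrow>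
        br (xs @ [br ys]) = (\<Sum>i<n. br (ys[i := br (xs @ [ys ! i])]))"

locale n_LieRep_pair = n_Lie_algebra n sg br
  for n :: nat
    and sg :: "'k::{alg_closed_field, field_char_0} \<Rightarrow> 'g::ab_group_add \<Rightarrow> 'g"
    and br :: "'g list \<Rightarrow> 'g" +
  fixes sv :: "'k \<Rightarrow> 'v::ab_group_add \<Rightarrow> 'v"
    and \<rho> :: "'g list \<Rightarrow> 'v \<Rightarrow> 'v"
  assumes finite_dim_V: "finite_dim sv"
    and rho_linear: "length xs = n - 1 \<Longrightarrow> Vector_Spaces.linear sv sv (\<rho> xs)"
    and rho_alternating: "alternating_multilinear (n - 1) sg sv (\<lambda>xs. \<rho> xs v)"
    and rho_commutator:
      "length xs = n - 1 \<Longrightarrow> length ys = n - 1 \<Longrightarrow>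
        \<rho> xs (\<rho> ys v) - \<rho> ys (\<rho> xs v) = (\<Sum>i<n - 1. \<rho> (ys[i := br (xs @ [ys ! i])]) v)"
    and rho_bracket:
      "length xs = n - 2 \<Longrightarrow> length ys = n \<Longrightarrow>
        \<rho> (xs @ [br ys]) v = (\<Sum>i<n. signed (n - Suc i) (\<rho> (omit i ys) (\<rho> (xs @ [ys ! i]) v)))"

definition relative_Rota_Baxter ::
  "nat \<Rightarrow> ('k::field \<Rightarrow> 'g::ab_group_add \<Rightarrow> 'g) \<Rightarrow> ('g list \<Rightarrow> 'g) \<Rightarrow>
   ('k \<Rightarrow> 'v::ab_group_add \<Rightarrow> 'v) \<Rightarrow> ('g list \<Rightarrow> 'v \<Rightarrow> 'v) \<Rightarrow> ('v \<Rightarrow> 'g) \<Rightarrow> bool"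
where
  "relative_Rota_Baxter n sg br sv \<rho> T \<longleftrightarrow>
     Vector_Spaces.linear sv sg T \<and>
     (\<forall>vs. length vs = n \<longrightarrow>
        br (map T vs) = (\<Sum>i<n. signed (n - Suc i) (T (\<rho> (map T (omit i vs)) (vs ! i)))))"

section \<open>Deformations\<close>

text \<open>
  Elements of \<open>W[t]/(t\<^sup>N)\<close> are represented by polynomials with coefficients in \<open>W\<close>, compared modulo
  \<open>t\<^sup>N\<close>. The three operations below are the \<open>K[t]\<close>-(multi)linear extensions of the bracket, of the
  action \<open>\<rho>\<close>, and of the family \<open>\<TT>\<^sub>0 + \<TT>\<^sub>1 t + \<dots> + \<TT>\<^sub>m t\<^sup>m\<close>; being \<open>K[t]\<close>-linear, they are compatible
  with congruence modulo \<open>t\<^sup>N\<close>.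
\<close>

definition eq_mod_tpow :: "nat \<Rightarrow> 'a::zero poly \<Rightarrow> 'a poly \<Rightarrow> bool" where
  "eq_mod_tpow N p q \<longleftrightarrow> (\<forall>k<N. coeff p k = coeff q k)"

definition ext_br :: "('a::ab_group_add list \<Rightarrow> 'b::ab_group_add) \<Rightarrow> 'a poly list \<Rightarrow> 'b poly" where
  "ext_br \<phi> ps =
     (\<Sum>is\<in>listset (map (\<lambda>p. {..degree p}) ps). monom (\<phi> (map2 coeff ps is)) (sum_list is))"

definition ext_rho ::
  "('a::ab_group_add list \<Rightarrow> 'b::ab_group_add \<Rightarrow> 'b) \<Rightarrow> 'a poly list \<Rightarrow> 'b poly \<Rightarrow> 'b poly" where
  "ext_rho \<rho> ps q =
     (\<Sum>is\<in>listset (map (\<lambda>p. {..degree p}) ps). \<Sum>j\<le>degree q.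
        monom (\<rho> (map2 coeff ps is) (coeff q j)) (sum_list is + j))"

definition ext_map ::
  "nat \<Rightarrow> (nat \<Rightarrow> 'a::ab_group_add \<Rightarrow> 'b::ab_group_add) \<Rightarrow> 'a poly \<Rightarrow> 'b poly" where
  "ext_map m TT p = (\<Sum>i\<le>m. \<Sum>j\<le>degree p. monom (TT i (coeff p j)) (i + j))"

text \<open>Only \<open>TT 0, \<dots>, TT m\<close> are relevant. The element \<open>u\<close> of \<open>V\<close> is the constant polynomial
  \<open>[:u:]\<close>.\<close>

definition deformation ::
  "nat \<Rightarrow> ('k::field \<Rightarrow> 'g::ab_group_add \<Rightarrow> 'g) \<Rightarrow> ('g list \<Rightarrow> 'g) \<Rightarrow>
   ('k \<Rightarrow> 'v::ab_group_add \<Rightarrow> 'v) \<Rightarrow> ('g list \<Rightarrow> 'v \<Rightarrow> 'v) \<Rightarrow> ('v \<Rightarrow> 'g) \<Rightarrow>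
   nat \<Rightarrow> (nat \<Rightarrow> 'v \<Rightarrow> 'g) \<Rightarrow> bool"
where
  "deformation n sg br sv \<rho> T m TT \<longleftrightarrow>
     (\<forall>i\<le>m. Vector_Spaces.linear sv sg (TT i)) \<and> TT 0 = T \<and>
     (\<forall>us. length us = n \<longrightarrow>
        (let Tt = ext_map m TT; ps = map (\<lambda>u. [:u:]) us
         in eq_mod_tpow (m + 1)
              (ext_br br (map Tt ps))
              (Tt (\<Sum>i<n. signed (n - Suc i) (ext_rho \<rho> (map Tt (omit i ps)) (ps ! i))))))"

definition extendable ::
  "nat \<Rightarrow> ('k::field \<Rightarrow> 'g::ab_group_add \<Rightarrow> 'g) \<Rightarrow> ('g list \<Rightarrow> 'g) \<Rightarrow>
   ('k \<Rightarrow> 'v::ab_group_add \<Rightarrow> 'v) \<Rightarrow> ('g list \<Rightarrow> 'v \<Rightarrow> 'v) \<Rightarrow> ('v \<Rightarrow> 'g) \<Rightarrow>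
   nat \<Rightarrow> (nat \<Rightarrow> 'v \<Rightarrow> 'g) \<Rightarrow> bool"
where
  "extendable n sg br sv \<rho> T m TT \<longleftrightarrow>
     (\<exists>S. Vector_Spaces.linear sv sg S \<and> deformation n sg br sv \<rho> T (m + 1) (TT(m + 1 := S)))"

section \<open>Cohomology of a relative Rota-Baxter operator\<close>

definition bracket_T ::
  "nat \<Rightarrow> ('g list \<Rightarrow> 'v \<Rightarrow> 'v::ab_group_add) \<Rightarrow> ('v \<Rightarrow> 'g) \<Rightarrow> 'v list \<Rightarrow> 'v" where
  "bracket_T n \<rho> T us = (\<Sum>i<n. signed (n - Suc i) (\<rho> (map T (omit i us)) (us ! i)))"

definition rho_T ::
  "nat \<Rightarrow> ('g list \<Rightarrow> 'g::ab_group_add) \<Rightarrow> ('g list \<Rightarrow> 'v \<Rightarrow> 'v) \<Rightarrow> ('v \<Rightarrow> 'g) \<Rightarrow>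
   'v list \<Rightarrow> 'g \<Rightarrow> 'g" where
  "rho_T n br \<rho> T us x =
     br (map T us @ [x]) -
     (\<Sum>i<n - 1. signed (n - Suc i) (T (\<rho> (map T (omit i us) @ [x]) (us ! i))))"

text \<open>
  An \<open>m\<close>-cochain (\<open>m \<ge> 1\<close>) takes a list of \<open>m - 1\<close> lists of length \<open>n - 1\<close>, the decomposables
  \<open>\<UU>\<^sub>1, \<dots>, \<UU>\<^bsub>m-1\<^esub>\<close>, and a vector \<open>u\<close>. It is multilinear in all entries and alternating in each
  \<open>\<UU>\<^sub>j\<close>; for \<open>m \<ge> 2\<close> it is moreover alternating in \<open>\<UU>\<^bsub>m-1\<^esub>\<close> and \<open>u\<close> jointly. Outside the lists of this
  shape its value is 0, so that a cochain is determined by the map it represents.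
\<close>

definition cochain_args :: "nat \<Rightarrow> nat \<Rightarrow> 'v list list \<Rightarrow> bool" where
  "cochain_args n m Us \<longleftrightarrow> length Us = m - 1 \<and> (\<forall>U\<in>set Us. length U = n - 1)"

definition cochains ::
  "nat \<Rightarrow> ('k::field \<Rightarrow> 'g::ab_group_add \<Rightarrow> 'g) \<Rightarrow> ('k \<Rightarrow> 'v::ab_group_add \<Rightarrow> 'v) \<Rightarrow>
   nat \<Rightarrow> ('v list list \<Rightarrow> 'v \<Rightarrow> 'g) set"
where
  "cochains n sg sv m = {f.
     (\<forall>Us u. \<not> cochain_args n m Us \<longrightarrow> f Us u = 0) \<and>
     (\<forall>Us. cochain_args n m Us \<longrightarrow> Vector_Spaces.linear sv sg (\<lambda>u. f Us u)) \<and>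
     (\<forall>Us u j. cochain_args n m Us \<and> j < m - 1 \<longrightarrow>
        alternating_multilinear (n - 1) sv sg (\<lambda>U. f (Us[j := U]) u)) \<and>
     (\<forall>Us u. cochain_args n m Us \<and> m \<ge> 2 \<and> u \<in> set (last Us) \<longrightarrow> f Us u = 0)}"

text \<open>
  The differential \<open>C\<^sup>m \<rightarrow> C\<^bsup>m+1\<^esup>\<close> for \<open>m \<ge> 1\<close>. In the first sum, \<open>f\<close> is evaluated at
  \<open>\<UU>\<^sub>j \<circ> \<UU>\<^sub>k\<close> by linearity, since \<open>\<UU>\<^sub>j \<circ> \<UU>\<^sub>k\<close> is a sum of decomposables.
\<close>

definition differential ::
  "nat \<Rightarrow> ('g list \<Rightarrow> 'g::ab_group_add) \<Rightarrow> ('g list \<Rightarrow> 'v::ab_group_add \<Rightarrow> 'v) \<Rightarrow> ('v \<Rightarrow> 'g) \<Rightarrow>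
   nat \<Rightarrow> ('v list list \<Rightarrow> 'v \<Rightarrow> 'g) \<Rightarrow> 'v list list \<Rightarrow> 'v \<Rightarrow> 'g"
where
  "differential n br \<rho> T m f = (\<lambda>Us u.
     if cochain_args n (m + 1) Us then
       (\<Sum>k<m. \<Sum>j<k. signed (Suc j)
          (\<Sum>i<n - 1. f (omit j (Us[k := (Us ! k)[i := bracket_T n \<rho> T (Us ! j @ [Us ! k ! i])]])) u))
     + (\<Sum>j<m. signed (Suc j) (f (omit j Us) (bracket_T n \<rho> T (Us ! j @ [u]))))
     + (\<Sum>j<m. signed (Suc j + 1) (rho_T n br \<rho> T (Us ! j) (f (omit j Us) u)))
     + (\<Sum>i<n - 1. signed (n + m - Suc i + 1)
          (rho_T n br \<rho> T (omit i (Us ! (m - 1)) @ [u]) (f (take (m - 1) Us) (Us ! (m - 1) ! i))))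
     else 0)"

definition differential0 ::
  "('g list \<Rightarrow> 'g::ab_group_add) \<Rightarrow> ('g list \<Rightarrow> 'v \<Rightarrow> 'v) \<Rightarrow> ('v \<Rightarrow> 'g) \<Rightarrow> 'g list \<Rightarrow> 'v \<Rightarrow> 'g" where
  "differential0 br \<rho> T xs v = T (\<rho> xs v) - br (xs @ [T v])"

definition cocycles where
  "cocycles n sg br sv \<rho> T m = {f \<in> cochains n sg sv m. differential n br \<rho> T m f = (\<lambda>Us u. 0)}"

text \<open>
  \<open>C\<^sup>0 = \<Wedge>\<^bsup>n-1\<^esup> g\<close> enters cohomology in positive degrees only through its image in \<open>C\<^sup>1\<close>; as each of its
  elements is a finite sum of decomposables, that image consists of the finite sums of differentials
  of decomposables.
\<close>

definition coboundaries where
  "coboundaries n sg br sv \<rho> T m =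
     (if m = 1
      then {(\<lambda>Us u. if Us = [] then \<Sum>xs\<leftarrow>Xs. differential0 br \<rho> T xs u else 0) | Xs.
              \<forall>xs\<in>set Xs. length xs = n - 1}
      else differential n br \<rho> T (m - 1) ` cochains n sg sv (m - 1))"

definition cocycle_group where
  "cocycle_group n sg br sv \<rho> T m =
     \<lparr>carrier = cocycles n sg br sv \<rho> T m,
      monoid.mult = (\<lambda>f g Us u. f Us u + g Us u),
      one = (\<lambda>Us u. 0)\<rparr>"

text \<open>The \<open>m\<close>-th cohomology group, for \<open>m \<ge> 1\<close>, written multiplicatively as usual in HOL-Algebra;
  its neutral element is the trivial class.\<close>

definition cohomology_group where
  "cohomology_group n sg br sv \<rho> T m =
     cocycle_group n sg br sv \<rho> T m Mod coboundaries n sg br sv \<rho> T m"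

definition cohomology_class where
  "cohomology_class n sg br sv \<rho> T m f =
     coboundaries n sg br sv \<rho> T m #>\<^bsub>cocycle_group n sg br sv \<rho> T m\<^esub> f"

section \<open>The obstruction\<close>

definition Theta ::
  "nat \<Rightarrow> ('g list \<Rightarrow> 'g::ab_group_add) \<Rightarrow> ('g list \<Rightarrow> 'v::ab_group_add \<Rightarrow> 'v) \<Rightarrow>
   nat \<Rightarrow> (nat \<Rightarrow> 'v \<Rightarrow> 'g) \<Rightarrow> 'v list \<Rightarrow> 'g"
where
  "Theta n br \<rho> m TT us =
     (\<Sum>is\<in>{is. length is = n \<and> sum_list is = m + 1 \<and> (\<forall>i\<in>set is. i \<le> m)}.
        br (map2 TT is us)
        - TT (hd is) (\<Sum>k<n. signed (n - Suc k) (\<rho> (map2 TT (tl is) (omit k us)) (us ! k))))"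

text \<open>The identification of \<open>Hom(\<Wedge>\<^sup>n V, g)\<close> with \<open>C\<^sup>2\<close>.\<close>

definition as_2cochain :: "nat \<Rightarrow> ('v list \<Rightarrow> 'g::zero) \<Rightarrow> 'v list list \<Rightarrow> 'v \<Rightarrow> 'g" where
  "as_2cochain n \<phi> = (\<lambda>Us u. if cochain_args n 2 Us then \<phi> (hd Us @ [u]) else 0)"

end

theory Submission
  imports Defs
begin

text \<open>
  The relative Rota-Baxter identity for \<open>T\<^sub>t = \<Sum>\<^sub>i \<TT>\<^sub>i t\<^sup>i\<close> is compared coefficient by coefficient. The
  coefficient of \<open>t\<^sup>K\<close> involves only \<open>\<TT>\<^sub>0, \<dots>, \<TT>\<^sub>K\<close>, so adding a term \<open>S t\<^bsup>m+1\<^esup>\<close> leaves the identity modulo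
  \<open>t\<^bsup>m+1\<^esup>\<close> intact, and only the coefficient of \<open>t\<^bsup>m+1\<^esup>\<close> imposes a new condition (\<open>deformation_iff\<close>,
  \<open>rb_defect_cong\<close>). That coefficient is a sum over the tuples \<open>(i\<^sub>1, \<dots>, i\<^sub>n)\<close> with
  \<open>i\<^sub>1 + \<dots> + i\<^sub>n = m + 1\<close>. The tuples with all entries at most \<open>m\<close> contribute \<open>\<Theta>\<^sub>m\<close>. Each remaining tuple
  has one entry \<open>m + 1\<close> and all others 0; together these contribute the linearization at \<open>T\<close> of the
  identity in the direction \<open>S\<close>, namely
  \<open>\<Sum>\<^sub>i [Tu\<^sub>1, \<dots>, Su\<^sub>i, \<dots>, Tu\<^sub>n] - S[u\<^sub>1, \<dots>, u\<^sub>n]\<^sub>T - \<Sum>\<^sub>k \<Sum>\<^bsub>i\<noteq>k\<^esub> (-1)\<^bsup>n-k\<^esup> T(\<rho>(\<dots>, Su\<^sub>i, \<dots>)(u\<^sub>k))\<close>,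
  where the arguments of \<open>\<rho>\<close> are \<open>Tu\<^sub>1, \<dots>, Tu\<^sub>n\<close> without \<open>Tu\<^sub>k\<close> and with \<open>Tu\<^sub>i\<close> replaced by \<open>Su\<^sub>i\<close>.
  Since the bracket and \<open>\<rho>\<close> are alternating, the argument \<open>Su\<^sub>i\<close> can be moved to the last position
  (\<open>signed_rho_T_omit\<close>), and the expression becomes \<open>(dS)(u\<^sub>1, \<dots>, u\<^sub>n)\<close> (\<open>rb_defect_top\<close>). Hence \<open>S\<close>
  extends \<open>T\<^sub>t\<close> if and only if \<open>\<Theta>\<^sub>m + dS = 0\<close>, that is, \<open>\<Theta>\<^sub>m = d(-S)\<close>; such an \<open>S\<close>
  exists if and only if \<open>\<Theta>\<^sub>m\<close> is a coboundary.

  The class of a cochain \<open>f\<close> is the coset \<open>B + f\<close> of the coboundaries, and the trivial class is \<open>B\<close>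
  itself; as \<open>B\<close> contains 0 and is closed under subtraction, \<open>B + f = B\<close> if and only if \<open>f \<in> B\<close>
  (\<open>cohomology_class_trivial_iff\<close>).
\<close>

section \<open>Linear maps, signs and omission of list entries\<close>

lemma linear_module_hom: "Vector_Spaces.linear s1 s2 f \<Longrightarrow> module_hom s1 s2 f"
  by (simp add: Vector_Spaces.linear_iff_module_hom)

lemmas linear_0 = module_hom.zero[OF linear_module_hom]
lemmas linear_add = module_hom.add[OF linear_module_hom]
lemmas linear_diff = module_hom.diff[OF linear_module_hom]
lemmas linear_uminus = module_hom.neg[OF linear_module_hom]
lemmas linear_sum = module_hom.sum[OF linear_module_hom]

lemma linear_zero_map:
  assumes "vector_space s1" "vector_space s2"
  shows "Vector_Spaces.linear s1 s2 (\<lambda>x. 0)"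
proof -
  interpret vector_space_pair s1 s2 using assms by (simp add: vector_space_pair_def)
  show ?thesis by (rule module_hom_zero[unfolded linear_iff_module_hom[symmetric]])
qed

lemma linear_diff_map:
  assumes "Vector_Spaces.linear s1 s2 f" "Vector_Spaces.linear s1 s2 g"
  shows "Vector_Spaces.linear s1 s2 (\<lambda>x. f x - g x)"
proof -
  interpret f: Vector_Spaces.linear s1 s2 f by fact
  interpret vector_space_pair s1 s2 by unfold_locales
  show ?thesis using assms by (rule linear_compose_sub)
qed

lemma finite_dim_vector_space: "finite_dim s \<Longrightarrow> vector_space s"
  by (auto simp: finite_dim_def finite_dimensional_vector_space_def)

lemma signed_signed [simp]: "signed k (signed l x) = signed (k + l) x"
  by (auto simp: signed_def)

lemma signed_cong_parity: "even k = even l \<Longrightarrow> signed k x = signed l x"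
  by (simp add: signed_def)

lemma signed_diff: "signed k (x - y) = signed k x - signed k y"
  by (simp add: signed_def)

lemma signed_sum: "signed k (sum f A) = (\<Sum>x\<in>A. signed k (f x))"
  by (simp add: signed_def sum_negf)

lemma coeff_signed: "coeff (signed k p) i = signed k (coeff p i)"
  by (simp add: signed_def)

lemma linear_signed: "Vector_Spaces.linear s1 s2 f \<Longrightarrow> f (signed k x) = signed k (f x)"
  by (simp add: signed_def linear_uminus)

lemma length_omit [simp]: "i < length xs \<Longrightarrow> length (omit i xs) = length xs - 1"
  by (simp add: omit_def)

lemma omit_update_same [simp]: "omit i (ys[i := x]) = omit i ys"
  by (simp add: omit_def)

text \<open>The increasing enumeration of the positions other than \<open>k\<close>.\<close>

definition skip :: "nat \<Rightarrow> nat \<Rightarrow> nat" where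
  "skip k j = (if j < k then j else Suc j)"

lemma nth_omit: "k < length xs \<Longrightarrow> j < length xs - 1 \<Longrightarrow> omit k xs ! j = xs ! skip k j"
  by (auto simp: omit_def skip_def nth_append)

lemma map_omit: "map f (omit k xs) = omit k (map f xs)"
  by (simp add: omit_def take_map drop_map)

lemma omit_append_last: "i < length xs \<Longrightarrow> omit i (xs @ [u]) = omit i xs @ [u]"
  by (simp add: omit_def)

lemma omit_length_append: "omit (length xs) (xs @ [u]) = xs"
  by (simp add: omit_def)

lemma omit_skip_update:
  assumes "k < length ys" "j < length ys - 1"
  shows "omit k (ys[skip k j := x]) = (omit k ys)[j := x]"
  by (rule nth_equalityI) (use assms in \<open>auto simp: nth_omit nth_list_update skip_def\<close>)

lemma sum_skip:
  assumes "k < n"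
  shows "(\<Sum>j<n - 1. F (skip k j)) = (\<Sum>i\<in>{..<n} - {k}. F i)"
  by (rule sum.reindex_bij_witness[where j = "skip k" and i = "\<lambda>i. if i < k then i else i - 1"])
     (use assms in \<open>auto simp: skip_def\<close>)

section \<open>Alternating multilinear maps\<close>

lemma alternating_multilinearD:
  assumes "alternating_multilinear n s1 s2 \<phi>"
  shows alternating_multilinear_linear:
      "length xs = n \<Longrightarrow> i < n \<Longrightarrow> Vector_Spaces.linear s1 s2 (\<lambda>x. \<phi> (xs[i := x]))"
    and alternating_multilinear_eq_0:
      "length xs = n \<Longrightarrow> i < n \<Longrightarrow> j < n \<Longrightarrow> i \<noteq> j \<Longrightarrow> xs ! i = xs ! j \<Longrightarrow> \<phi> xs = 0"
  using assms unfolding alternating_multilinear_def by blast+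

lemma alternating_multilinear_zero_arg:
  assumes "alternating_multilinear n s1 s2 \<phi>" "length xs = n" "0 \<in> set xs"
  shows "\<phi> xs = 0"
proof -
  obtain i where "i < n" "xs ! i = 0" using assms by (metis in_set_conv_nth)
  with linear_0[OF alternating_multilinear_linear[OF assms(1,2), of i]]
  show ?thesis by (metis list_update_id)
qed

lemma alternating_multilinear_last_diff:
  assumes "alternating_multilinear n s1 s2 \<phi>" "Suc (length xs) = n"
  shows "\<phi> (xs @ [x - y]) = \<phi> (xs @ [x]) - \<phi> (xs @ [y])"
  using linear_diff[OF alternating_multilinear_linear[OF assms(1), of "xs @ [0]" "length xs"], of x y]
    assms(2) by simp

lemma alternating_multilinear_swap:
  assumes alt: "alternating_multilinear n s1 s2 \<phi>"
    and len: "length xs = n" "i < n" "j < n" "i \<noteq> j"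
  shows "\<phi> (xs[i := xs ! j, j := xs ! i]) = - \<phi> xs"
proof -
  define a b where "a = xs ! i" and "b = xs ! j"
  define F where "F x y = \<phi> (xs[i := x, j := y])" for x y
  have lin1: "F (x + x') y = F x y + F x' y" for x x' y
    using linear_add[OF alternating_multilinear_linear[OF alt, of "xs[j := y]" i], of x x'] len
    by (simp add: F_def list_update_swap)
  have lin2: "F x (y + y') = F x y + F x y'" for x y y'
    using linear_add[OF alternating_multilinear_linear[OF alt, of "xs[i := x]" j], of y y'] len
    by (simp add: F_def)
  have diag: "F x x = 0" for x
    unfolding F_def by (rule alternating_multilinear_eq_0[OF alt, of _ i j]) (use len in auto)
  \<comment> \<open>Expand \<open>F (a + b) (a + b) = 0\<close>.\<close>
  have "F (a + b) (a + b) = F a b + F b a"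
    by (simp only: lin1 lin2) (simp add: diag add.commute)
  then have "F b a = - F a b" by (simp add: diag eq_neg_iff_add_eq_0 add.commute)
  then show ?thesis using len by (simp add: F_def a_def b_def list_update_same_conv)
qed

text \<open>Moving the entry at position \<open>i\<close> to the end takes \<open>n - 1 - i\<close> transpositions of neighbours.\<close>

lemma alternating_multilinear_move_last:
  assumes alt: "alternating_multilinear n s1 s2 \<phi>"
  shows "length ys = n \<Longrightarrow> i < n \<Longrightarrow> \<phi> (omit i ys @ [ys ! i]) = signed (n - Suc i) (\<phi> ys)"
proof (induction "n - Suc i" arbitrary: i ys)
  case 0
  then have "omit i ys @ [ys ! i] = ys"
    by (metis One_nat_def Suc_diff_Suc Suc_lessI append.right_neutral diff_Suc_1 diff_is_0_eq
        drop_all id_take_nth_drop le_refl omit_def zero_less_diff leD)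
  then show ?case using 0 by (simp add: signed_def)
next
  case (Suc d)
  then have i: "Suc i < n" by linarith
  define zs where "zs = ys[i := ys ! Suc i, Suc i := ys ! i]"
  have eq: "omit (Suc i) zs @ [zs ! Suc i] = omit i ys @ [ys ! i]"
    by (rule nth_equalityI)
       (use i Suc.prems in \<open>auto simp: zs_def nth_append nth_omit nth_list_update skip_def less_Suc_eq\<close>)
  have "\<phi> (omit (Suc i) zs @ [zs ! Suc i]) = signed (n - Suc (Suc i)) (\<phi> zs)"
    by (rule Suc.hyps(1)) (use Suc.hyps(2) Suc.prems i in \<open>auto simp: zs_def\<close>)
  then have "\<phi> (omit i ys @ [ys ! i]) = signed (n - Suc (Suc i)) (\<phi> zs)"
    unfolding eq .
  also have "\<phi> zs = - \<phi> ys"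
    unfolding zs_def by (rule alternating_multilinear_swap[OF alt]) (use i Suc.prems in auto)
  also have "signed (n - Suc (Suc i)) (- \<phi> ys) = signed (n - Suc i) (\<phi> ys)"
    using i by (auto simp: signed_def Suc_diff_Suc[symmetric])
  finally show ?case .
qed

section \<open>Deformations in terms of coefficients\<close>

lemma mem_listset_iff: "I \<in> listset As \<longleftrightarrow> list_all2 (\<in>) I As"
  by (induction As arbitrary: I) (auto simp: set_Cons_def list_all2_Cons2)

lemma finite_listset: "(\<And>A. A \<in> set As \<Longrightarrow> finite A) \<Longrightarrow> finite (listset As)"
proof (induction As)
  case (Cons A As)
  have "set_Cons A (listset As) = (\<lambda>(x, xs). x # xs) ` (A \<times> listset As)"
    by (auto simp: set_Cons_def)
  with Cons show ?case by simp
qed simp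

text \<open>The index tuples of the terms that contribute to the coefficient of \<open>t\<^sup>K\<close> in an \<open>n\<close>-fold
  product.\<close>

definition compositions :: "nat \<Rightarrow> nat \<Rightarrow> nat list set" where
  "compositions n K = {I. length I = n \<and> sum_list I = K}"

lemma compositions_le: "I \<in> compositions n K \<Longrightarrow> i \<in> set I \<Longrightarrow> i \<le> K"
  by (auto simp: compositions_def member_le_sum_list)

lemma finite_compositions: "finite (compositions n K)"
proof (rule finite_subset)
  show "compositions n K \<subseteq> {I. set I \<subseteq> {..K} \<and> length I = n}"
    using compositions_le by (auto simp: compositions_def)
qed (rule finite_lists_length_eq, simp)

text \<open>The sum in \<open>ext_br\<close> runs over exponents bounded by the degrees; beyond them a coefficient, and
  hence the value of \<open>\<phi>\<close>, is 0, so the bound can be dropped.\<close>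

lemma coeff_ext_br:
  assumes "\<And>xs. length xs = length ps \<Longrightarrow> 0 \<in> set xs \<Longrightarrow> \<phi> xs = 0"
  shows "coeff (ext_br \<phi> ps) K = (\<Sum>I\<in>compositions (length ps) K. \<phi> (map2 coeff ps I))"
proof -
  let ?L = "listset (map (\<lambda>p. {..degree p}) ps)"
  have fin: "finite ?L" by (rule finite_listset) auto
  have L: "I \<in> ?L \<longleftrightarrow> length I = length ps \<and> (\<forall>i<length ps. I ! i \<le> degree (ps ! i))" for I
    by (auto simp: mem_listset_iff list_all2_conv_all_nth)
  have "coeff (ext_br \<phi> ps) K = (\<Sum>I\<in>?L. if sum_list I = K then \<phi> (map2 coeff ps I) else 0)"
    by (simp add: ext_br_def coeff_sum)
  also have "\<dots> = (\<Sum>I\<in>{I\<in>?L. sum_list I = K}. \<phi> (map2 coeff ps I))"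
    using fin by (simp add: sum.inter_filter)
  also have "\<dots> = (\<Sum>I\<in>compositions (length ps) K. \<phi> (map2 coeff ps I))"
  proof (rule sum.mono_neutral_left[OF finite_compositions])
    show "{I\<in>?L. sum_list I = K} \<subseteq> compositions (length ps) K"
      by (auto simp: compositions_def L)
    show "\<forall>I\<in>compositions (length ps) K - {I\<in>?L. sum_list I = K}. \<phi> (map2 coeff ps I) = 0"
    proof
      fix I assume I: "I \<in> compositions (length ps) K - {I\<in>?L. sum_list I = K}"
      then obtain i where i: "i < length ps" "degree (ps ! i) < I ! i" "length I = length ps"
        by (auto simp: L compositions_def not_le)
      then have "map2 coeff ps I ! i = 0" by (simp add: coeff_eq_0)
      with i have "0 \<in> set (map2 coeff ps I)"
        by (metis length_map length_zip min.idem nth_mem)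
      then show "\<phi> (map2 coeff ps I) = 0" using i(3) by (intro assms) auto
    qed
  qed
  finally show ?thesis .
qed

lemma ext_rho_const: "ext_rho \<rho> ps [:u:] = ext_br (\<lambda>xs. \<rho> xs u) ps"
  by (simp add: ext_rho_def ext_br_def)

lemma coeff_ext_map:
  assumes "\<And>i. i \<le> m \<Longrightarrow> TT i 0 = 0" "K \<le> m"
  shows "coeff (ext_map m TT p) K = (\<Sum>i\<le>K. TT i (coeff p (K - i)))"
proof -
  have inner: "(\<Sum>j\<le>degree p. if i + j = K then TT i (coeff p j) else 0)
      = (if i \<le> K then TT i (coeff p (K - i)) else 0)" if "i \<le> m" for i
  proof (cases "i \<le> K")
    case True
    have "(\<Sum>j\<le>degree p. if i + j = K then TT i (coeff p j) else 0)
        = (\<Sum>j\<le>degree p. if j = K - i then TT i (coeff p j) else 0)"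
      by (rule sum.cong) (use True in auto)
    also have "\<dots> = TT i (coeff p (K - i))"
      using assms(1)[OF that] by (auto simp: sum.delta coeff_eq_0 not_le)
    finally show ?thesis using True by simp
  qed (auto intro!: sum.neutral)
  have "coeff (ext_map m TT p) K
      = (\<Sum>i\<le>m. \<Sum>j\<le>degree p. if i + j = K then TT i (coeff p j) else 0)"
    by (simp add: ext_map_def coeff_sum)
  also have "\<dots> = (\<Sum>i\<le>m. if i \<le> K then TT i (coeff p (K - i)) else 0)"
    by (rule sum.cong) (auto simp: inner)
  also have "\<dots> = (\<Sum>i\<in>{i\<in>{..m}. i \<le> K}. TT i (coeff p (K - i)))"
    by (rule sum.inter_filter[symmetric]) simp
  also have "{i\<in>{..m}. i \<le> K} = {..K}" using assms(2) by auto
  finally show ?thesis .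
qed

lemma coeff_ext_map_const: "j \<le> m \<Longrightarrow> coeff (ext_map m TT [:u:]) j = TT j u"
  by (simp add: ext_map_def coeff_sum sum.delta)

lemma coeff_ext_br_ext_map:
  assumes "\<And>xs. length xs = length us \<Longrightarrow> 0 \<in> set xs \<Longrightarrow> \<phi> xs = 0" "K \<le> m"
  shows "coeff (ext_br \<phi> (map (ext_map m TT) (map (\<lambda>u. [:u:]) us))) K
    = (\<Sum>I\<in>compositions (length us) K. \<phi> (map2 TT I us))"
proof -
  have "map2 coeff (map (ext_map m TT) (map (\<lambda>u. [:u:]) us)) I = map2 TT I us"
    if I: "I \<in> compositions (length us) K" for I
  proof (rule nth_equalityI)
    fix i assume "i < length (map2 coeff (map (ext_map m TT) (map (\<lambda>u. [:u:]) us)) I)"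
    moreover have "I ! i \<le> m" if "i < length I"
      using compositions_le[OF I nth_mem[OF that]] assms(2) by simp
    ultimately show "map2 coeff (map (ext_map m TT) (map (\<lambda>u. [:u:]) us)) I ! i = map2 TT I us ! i"
      by (simp add: coeff_ext_map_const)
  qed (use I in \<open>simp add: compositions_def\<close>)
  then show ?thesis using coeff_ext_br[of "map (ext_map m TT) (map (\<lambda>u. [:u:]) us)" \<phi> K] assms(1)
    by simp
qed

lemma sum_compositions_Cons:
  assumes "n \<ge> 1"
  shows "(\<Sum>i\<le>K. \<Sum>J\<in>compositions (n - 1) (K - i). F i J) = (\<Sum>I\<in>compositions n K. F (hd I) (tl I))"
proof -
  have "(\<Sum>i\<le>K. \<Sum>J\<in>compositions (n - 1) (K - i). F i J)
      = (\<Sum>(i, J)\<in>(SIGMA i:{..K}. compositions (n - 1) (K - i)). F i J)"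
    by (rule sum.Sigma) (auto simp: finite_compositions)
  also have "\<dots> = (\<Sum>I\<in>compositions n K. F (hd I) (tl I))"
  proof (rule sum.reindex_bij_witness[where i = "\<lambda>I. (hd I, tl I)" and j = "\<lambda>(i, J). i # J"])
    fix I assume I: "I \<in> compositions n K"
    then obtain a J where "I = a # J" using assms by (cases I) (auto simp: compositions_def)
    then show "(case (hd I, tl I) of (i, J) \<Rightarrow> i # J) = I"
      "(hd I, tl I) \<in> (SIGMA i:{..K}. compositions (n - 1) (K - i))"
      using I by (auto simp: compositions_def)
  qed (use assms in \<open>auto simp: compositions_def\<close>)
  finally show ?thesis .
qed

text \<open>The coefficient of \<open>t\<^sup>K\<close> in the difference of the two sides of the relative Rota-Baxter
  identity for \<open>\<Sum>\<^sub>i TT i t\<^sup>i\<close>, evaluated at \<open>us\<close>.\<close>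

definition rb_defect ::
  "nat \<Rightarrow> ('g list \<Rightarrow> 'g::ab_group_add) \<Rightarrow> ('g list \<Rightarrow> 'v::ab_group_add \<Rightarrow> 'v) \<Rightarrow>
   (nat \<Rightarrow> 'v \<Rightarrow> 'g) \<Rightarrow> nat \<Rightarrow> 'v list \<Rightarrow> 'g"
where
  "rb_defect n br \<rho> TT K us =
     (\<Sum>I\<in>compositions n K. br (map2 TT I us)
        - TT (hd I) (\<Sum>k<n. signed (n - Suc k) (\<rho> (map2 TT (tl I) (omit k us)) (us ! k))))"

context n_LieRep_pair
begin

lemma rho_zero_arg: "length xs = n - 1 \<Longrightarrow> 0 \<in> set xs \<Longrightarrow> \<rho> xs v = 0"
  using alternating_multilinear_zero_arg[OF rho_alternating] .

lemma br_zero_arg: "length xs = n \<Longrightarrow> 0 \<in> set xs \<Longrightarrow> br xs = 0"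
  using alternating_multilinear_zero_arg[OF br_alternating] .

text \<open>On the right-hand side, the outer map contributes an index \<open>i\<close> and the \<open>n - 1\<close> arguments of \<open>\<rho>\<close>
  a composition of \<open>K - i\<close>; concatenated, they form a composition of \<open>K\<close> into \<open>n\<close> parts with head \<open>i\<close>.\<close>

lemma coeff_rb_identity:
  assumes lin: "\<And>i. i \<le> m \<Longrightarrow> Vector_Spaces.linear sv sg (TT i)"
    and us: "length us = n" and K: "K \<le> m"
  defines "Tt \<equiv> ext_map m TT" and "ps \<equiv> map (\<lambda>u. [:u:]) us"
  shows "coeff (ext_br br (map Tt ps)) K
      - coeff (Tt (\<Sum>i<n. signed (n - Suc i) (ext_rho \<rho> (map Tt (omit i ps)) (ps ! i)))) K
    = rb_defect n br \<rho> TT K us"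
proof -
  let ?P = "\<Sum>i<n. signed (n - Suc i) (ext_rho \<rho> (map Tt (omit i ps)) (ps ! i))"
  let ?R = "\<lambda>J. \<Sum>k<n. signed (n - Suc k) (\<rho> (map2 TT J (omit k us)) (us ! k))"
  have P: "coeff ?P l = (\<Sum>J\<in>compositions (n - 1) l. ?R J)" if l: "l \<le> m" for l
  proof -
    have "coeff (ext_rho \<rho> (map Tt (omit k ps)) (ps ! k)) l
        = (\<Sum>J\<in>compositions (n - 1) l. \<rho> (map2 TT J (omit k us)) (us ! k))" if "k < n" for k
      using coeff_ext_br_ext_map[of "omit k us" "\<lambda>xs. \<rho> xs (us ! k)" l m TT] that us l
      by (simp add: Tt_def ps_def map_omit[symmetric] ext_rho_const rho_zero_arg del: map_map)
    then have "coeff ?P l = (\<Sum>k<n. \<Sum>J\<in>compositions (n - 1) l.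
        signed (n - Suc k) (\<rho> (map2 TT J (omit k us)) (us ! k)))"
      by (simp add: coeff_sum coeff_signed signed_sum)
    then show ?thesis by (subst (asm) sum.swap)
  qed
  have "coeff (Tt ?P) K = (\<Sum>i\<le>K. TT i (coeff ?P (K - i)))"
    unfolding Tt_def by (rule coeff_ext_map) (use lin linear_0 K in auto)
  also have "\<dots> = (\<Sum>i\<le>K. \<Sum>J\<in>compositions (n - 1) (K - i). TT i (?R J))"
    by (rule sum.cong) (use K in \<open>auto simp: P linear_sum[OF lin]\<close>)
  also have "\<dots> = (\<Sum>I\<in>compositions n K. TT (hd I) (?R (tl I)))"
    by (rule sum_compositions_Cons) (use n_ge_2 in simp)
  finally have R: "coeff (Tt ?P) K = (\<Sum>I\<in>compositions n K. TT (hd I) (?R (tl I)))" .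
  have L: "coeff (ext_br br (map Tt ps)) K = (\<Sum>I\<in>compositions n K. br (map2 TT I us))"
    using coeff_ext_br_ext_map[of us br K m TT] br_zero_arg us K
    by (simp add: Tt_def ps_def del: map_map)
  show ?thesis unfolding L R rb_defect_def by (simp add: sum_subtractf)
qed

lemma deformation_iff:
  "deformation n sg br sv \<rho> T m TT \<longleftrightarrow>
     (\<forall>i\<le>m. Vector_Spaces.linear sv sg (TT i)) \<and> TT 0 = T \<and>
     (\<forall>us. length us = n \<longrightarrow> (\<forall>K\<le>m. rb_defect n br \<rho> TT K us = 0))"
proof (cases "\<forall>i\<le>m. Vector_Spaces.linear sv sg (TT i)")
  case True
  define L where "L us = ext_br br (map (ext_map m TT) (map (\<lambda>u. [:u:]) us))" for us
  define R where "R us = ext_map m TT (\<Sum>i<n. signed (n - Suc i)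
      (ext_rho \<rho> (map (ext_map m TT) (omit i (map (\<lambda>u. [:u:]) us))) (map (\<lambda>u. [:u:]) us ! i)))" for us
  have LR: "rb_defect n br \<rho> TT K us = coeff (L us) K - coeff (R us) K"
    if "length us = n" "K \<le> m" for us K
    unfolding L_def R_def using coeff_rb_identity[of m TT us K] True that by simp
  have "deformation n sg br sv \<rho> T m TT \<longleftrightarrow>
      (\<forall>i\<le>m. Vector_Spaces.linear sv sg (TT i)) \<and> TT 0 = T \<and>
      (\<forall>us. length us = n \<longrightarrow> (\<forall>K<m + 1. coeff (L us) K = coeff (R us) K))"
    by (simp only: L_def R_def deformation_def eq_mod_tpow_def Let_def)
  then show ?thesis by (simp add: LR less_Suc_eq_le)
qed (unfold deformation_def, blast)

end

text \<open>The coefficient of \<open>t\<^sup>K\<close> only involves \<open>TT 0, \<dots>, TT K\<close>.\<close>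

lemma rb_defect_cong:
  assumes "\<And>i. i \<le> K \<Longrightarrow> TT i = TT' i" "n \<ge> 1"
  shows "rb_defect n br \<rho> TT K us = rb_defect n br \<rho> TT' K us"
  unfolding rb_defect_def
proof (rule sum.cong[OF refl])
  fix I assume I: "I \<in> compositions n K"
  then obtain a J where aJ: "I = a # J" using assms by (cases I) (auto simp: compositions_def)
  have le: "\<And>i. i \<in> set I \<Longrightarrow> TT i = TT' i" using compositions_le[OF I] assms(1) by blast
  have map2_tl: "map2 TT (tl I) xs = map2 TT' (tl I) xs" for xs
    by (rule map_cong) (use le aJ in \<open>auto dest: set_zip_leftD\<close>)
  have map2_I: "map2 TT I xs = map2 TT' I xs" for xs
    by (rule map_cong) (use le in \<open>auto dest: set_zip_leftD\<close>)
  have hd: "TT (hd I) = TT' (hd I)" using le aJ by simp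
  show "br (map2 TT I us)
        - TT (hd I) (\<Sum>k<n. signed (n - Suc k) (\<rho> (map2 TT (tl I) (omit k us)) (us ! k)))
    = br (map2 TT' I us)
        - TT' (hd I) (\<Sum>k<n. signed (n - Suc k) (\<rho> (map2 TT' (tl I) (omit k us)) (us ! k)))"
    by (simp only: map2_tl map2_I hd)
qed

section \<open>The obstruction as a coboundary\<close>

lemma sum_lessThan_last:
  fixes F :: "nat \<Rightarrow> 'a::comm_monoid_add"
  shows "n \<ge> 1 \<Longrightarrow> (\<Sum>i<n. F i) = (\<Sum>i<n - 1. F i) + F (n - 1)"
  by (cases n) auto

lemma sum_lessThan_first:
  fixes F :: "nat \<Rightarrow> 'a::comm_monoid_add"
  shows "n \<ge> 1 \<Longrightarrow> (\<Sum>i<n. F i) = F 0 + (\<Sum>i<n - 1. F (Suc i))"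
  by (cases n) (auto simp: sum.lessThan_Suc_shift simp del: sum.lessThan_Suc)

text \<open>A composition of \<open>m + 1\<close> either has all parts at most \<open>m\<close> or is \<open>m + 1\<close> at one position and 0
  elsewhere.\<close>

lemma top_compositions:
  assumes "n \<ge> 1"
  shows "compositions n (m + 1) =
      {I. length I = n \<and> sum_list I = m + 1 \<and> (\<forall>i\<in>set I. i \<le> m)} \<union>
      (\<lambda>p. (replicate n 0)[p := m + 1]) ` {..<n}" (is "_ = ?A \<union> ?B")
proof (intro subset_antisym subsetI)
  fix I assume I: "I \<in> compositions n (m + 1)"
  show "I \<in> ?A \<union> ?B"
  proof (cases "\<forall>i\<in>set I. i \<le> m")
    case False
    then obtain p where p: "p < length I" "I ! p = m + 1"
      using compositions_le[OF I] by (metis Suc_eq_plus1 in_set_conv_nth le_SucE)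
    have len: "length I = n" and "sum_list I = m + 1" using I by (auto simp: compositions_def)
    then have "(\<Sum>q<n. I ! q) = m + 1" by (simp add: sum_list_sum_nth atLeast0LessThan)
    then have "(\<Sum>q\<in>{..<n} - {p}. I ! q) = 0"
      using p len by (simp add: sum.remove[of "{..<n}" p])
    then have "I = (replicate n 0)[p := m + 1]"
      by (intro nth_equalityI) (use p len in \<open>auto simp: nth_list_update\<close>)
    then show ?thesis using p len by auto
  qed (use I in \<open>auto simp: compositions_def\<close>)
next
  fix I assume "I \<in> ?A \<union> ?B"
  then show "I \<in> compositions n (m + 1)"
    by (auto simp: compositions_def sum_list_update sum_list_replicate)
qed

context n_LieRep_pair
begin

lemma vector_space_g: "vector_space sg" and vector_space_V: "vector_space sv"
  using finite_dim_g finite_dim_V by (auto intro: finite_dim_vector_space)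

lemma rho_T_diff:
  assumes T: "Vector_Spaces.linear sv sg T" and U: "length U = n - 1"
  shows "rho_T n br \<rho> T U (x - y) = rho_T n br \<rho> T U x - rho_T n br \<rho> T U y"
proof -
  have "br (map T U @ [x - y]) = br (map T U @ [x]) - br (map T U @ [y])"
    by (rule alternating_multilinear_last_diff[OF br_alternating]) (use U n_ge_2 in auto)
  moreover have "\<rho> (map T (omit i U) @ [x - y]) v
      = \<rho> (map T (omit i U) @ [x]) v - \<rho> (map T (omit i U) @ [y]) v" if "i < n - 1" for i v
    by (rule alternating_multilinear_last_diff[OF rho_alternating]) (use U n_ge_2 that in auto)
  ultimately show ?thesis
    by (simp add: rho_T_def linear_diff[OF T] signed_diff sum_subtractf)
qed

text \<open>Moving the argument \<open>x\<close> of \<open>\<rho>\<^sub>T\<close> from the last position to position \<open>i\<close>: the terms of \<open>\<rho>\<^sub>T\<close>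
  become the terms of the two sides of the relative Rota-Baxter identity that contain \<open>T u\<^sub>i\<close> as an
  argument of the bracket or of \<open>\<rho>\<close>, with that argument replaced by \<open>x\<close>.\<close>

lemma signed_rho_T_omit:
  assumes T: "Vector_Spaces.linear sv sg T" and us: "length us = n" and i: "i < n"
  shows "signed (n - Suc i) (rho_T n br \<rho> T (omit i us) x) =
    br ((map T us)[i := x]) -
    (\<Sum>k\<in>{..<n} - {i}. signed (n - Suc k) (T (\<rho> (omit k ((map T us)[i := x])) (us ! k))))"
proof -
  define ys where "ys = (map T us)[i := x]"
  have len: "length ys = n" and ys_i: "ys ! i = x" and om: "map T (omit i us) = omit i ys"
    using us i by (auto simp: ys_def map_omit)
  have "br (map T (omit i us) @ [x]) = signed (n - Suc i) (br ys)"
    using alternating_multilinear_move_last[OF br_alternating len i] by (simp add: om ys_i)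
  then have 1: "signed (n - Suc i) (br (map T (omit i us) @ [x])) = br ys"
    by (simp add: signed_def)
  have 2: "signed (n - Suc i) (signed (n - Suc j) (T (\<rho> (map T (omit j (omit i us)) @ [x]) (omit i us ! j))))
      = signed (n - Suc (skip i j)) (T (\<rho> (omit (skip i j) ys) (us ! skip i j)))"
    if j: "j < n - 1" for j
  proof -
    define k where "k = skip i j"
    \<comment> \<open>\<open>k\<close> is the position in \<open>us\<close> of the \<open>j\<close>-th entry of \<open>omit i us\<close>, and \<open>p\<close> is the position of
        \<open>x\<close> in \<open>omit k ys\<close>.\<close>
    define p where "p = (if j < i then i - 1 else i)"
    have k: "k < n" and p: "p < n - 1" and ki: "skip k p = i"
      using i j by (auto simp: k_def p_def skip_def)
    have zs: "length (omit k ys) = n - 1" using k len by simp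
    have zs_p: "omit k ys ! p = x" using k p len by (simp add: nth_omit ki ys_i)
    have "map T (omit j (omit i us)) = omit p (omit k ys)"
    proof (rule nth_equalityI)
      show "length (map T (omit j (omit i us))) = length (omit p (omit k ys))"
        using us i j k p len by simp
      fix l assume "l < length (map T (omit j (omit i us)))"
      then have l: "l < n - 2" using us i j by simp
      have "map T (omit j (omit i us)) ! l = omit j (omit i ys) ! l"
        by (simp only: map_omit om[unfolded map_omit])
      also have "\<dots> = ys ! skip i (skip j l)"
        using i j l len by (simp add: nth_omit skip_def)
      also have "skip i (skip j l) = skip k (skip p l)"
        using i j by (auto simp: k_def p_def skip_def)
      also have "ys ! skip k (skip p l) = omit p (omit k ys) ! l"
        using k p l len by (simp add: nth_omit skip_def)
      finally show "map T (omit j (omit i us)) ! l = omit p (omit k ys) ! l" .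
    qed
    then have "\<rho> (map T (omit j (omit i us)) @ [x]) (omit i us ! j)
        = signed (n - 1 - Suc p) (\<rho> (omit k ys) (us ! k))"
      using alternating_multilinear_move_last[OF rho_alternating zs p] zs_p us i j
      by (simp add: nth_omit k_def)
    moreover have "even (n - Suc i + (n - Suc j) + (n - 1 - Suc p)) = even (n - Suc k)"
    proof (cases "j < i")
      case True
      then have "n - Suc j = n - Suc k" "n - Suc i = n - 1 - Suc p"
        by (auto simp: k_def p_def skip_def)
      then show ?thesis by (simp only: even_add) blast
    next
      case False
      then have "n - Suc j = Suc (n - Suc k)" "n - Suc i = Suc (n - 1 - Suc p)"
        using i j by (auto simp: k_def p_def skip_def)
      then show ?thesis by (simp only: even_add even_Suc) blast
    qed
    ultimately show ?thesis
      unfolding k_def[symmetric] using signed_cong_parity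
      by (simp only: linear_signed[OF T] signed_signed add.assoc) blast
  qed
  show ?thesis
    unfolding ys_def[symmetric] sum_skip[OF i, symmetric]
    by (simp add: rho_T_def signed_diff signed_sum 1 2 del: signed_signed)
qed

text \<open>On 1-cochains the term \<open>\<rho>\<^sub>T(U) f(u)\<close> of the differential is the summand for the last position of
  a single sum over the positions of \<open>u\<^sub>1, \<dots>, u\<^bsub>n-1\<^esub>, u\<close>.\<close>

lemma differential_1:
  assumes U: "length U = n - 1"
  shows "differential n br \<rho> T 1 f [U] u =
    (\<Sum>i<n. signed (n - Suc i) (rho_T n br \<rho> T (omit i (U @ [u])) (f [] ((U @ [u]) ! i))))
    - f [] (bracket_T n \<rho> T (U @ [u]))"
proof -
  have "differential n br \<rho> T 1 f [U] u =
      - f [] (bracket_T n \<rho> T (U @ [u])) + rho_T n br \<rho> T U (f [] u)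
      + (\<Sum>i<n - 1. signed (n + 1 - Suc i + 1) (rho_T n br \<rho> T (omit i U @ [u]) (f [] (U ! i))))"
    using U by (simp add: differential_def cochain_args_def omit_def signed_def)
  also have "(\<Sum>i<n - 1. signed (n + 1 - Suc i + 1) (rho_T n br \<rho> T (omit i U @ [u]) (f [] (U ! i))))
      = (\<Sum>i<n - 1. signed (n - Suc i) (rho_T n br \<rho> T (omit i (U @ [u])) (f [] ((U @ [u]) ! i))))"
    by (rule sum.cong)
       (use U in \<open>auto simp: omit_append_last nth_append signed_def Suc_diff_Suc Suc_diff_le\<close>)
  also have "rho_T n br \<rho> T U (f [] u)
      = signed (n - Suc (n - 1)) (rho_T n br \<rho> T (omit (n - 1) (U @ [u])) (f [] ((U @ [u]) ! (n - 1))))"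
  proof -
    have "omit (n - 1) (U @ [u]) = U" "(U @ [u]) ! (n - 1) = u"
      using omit_length_append[of U u] nth_append_length[of U u "[]"] U by simp_all
    then show ?thesis using n_ge_2 by (simp only:) (simp add: signed_def)
  qed
  finally show ?thesis using n_ge_2 by (simp add: sum_lessThan_last)
qed

text \<open>In the coefficient of \<open>t\<^bsup>m+1\<^esup>\<close>, the terms that contain \<open>S\<close> contain it exactly once, every other
  factor being \<open>T\<close>, and they add up to the differential of \<open>S\<close>.\<close>

lemma rb_defect_top:
  assumes T: "Vector_Spaces.linear sv sg T" and S: "f [] = S"
    and TT0: "TT 0 = T" and U: "length U = n - 1"
  shows "rb_defect n br \<rho> (TT(m + 1 := S)) (m + 1) (U @ [u]) =
    Theta n br \<rho> m TT (U @ [u]) + differential n br \<rho> T 1 f [U] u"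
proof -
  define us where "us = U @ [u]"
  have us: "length us = n" using U n_ge_2 by (simp add: us_def)
  define TT' where "TT' = TT(m + 1 := S)"
  define e where "e C I = br (map2 C I us)
      - C (hd I) (\<Sum>k<n. signed (n - Suc k) (\<rho> (map2 C (tl I) (omit k us)) (us ! k)))"
    for C :: "nat \<Rightarrow> 'v \<Rightarrow> 'g" and I
  define A where "A = {I. length I = n \<and> sum_list I = m + 1 \<and> (\<forall>i\<in>set I. i \<le> m)}"
  define top where "top p = (replicate n 0)[p := m + 1]" for p
  have comps: "compositions n (m + 1) = A \<union> top ` {..<n}"
    unfolding A_def top_def by (rule top_compositions) (use n_ge_2 in simp)
  have finA: "finite A"
    by (rule finite_subset[OF _ finite_compositions[of n "m + 1"]]) (use comps in blast)
  have top_p: "m + 1 \<in> set (top p)" if "p < n" for p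
    using that by (simp add: top_def set_update_memI)
  have disj: "A \<inter> top ` {..<n} = {}"
    using top_p by (fastforce simp: A_def)
  have inj: "inj_on top {..<n}"
  proof (rule inj_onI)
    fix p q assume pq: "p \<in> {..<n}" "q \<in> {..<n}" and eq: "top p = top q"
    show "p = q"
    proof (rule ccontr)
      assume "p \<noteq> q"
      then have "top q ! p = 0" "top p ! p = m + 1" using pq by (simp_all add: top_def)
      with eq show False by simp
    qed
  qed
  let ?G = "\<lambda>i k. signed (n - Suc k) (T (\<rho> (omit k ((map T us)[i := S (us ! i)])) (us ! k)))"
  have eA: "e TT' I = e TT I" if "I \<in> A" for I
  proof -
    have le: "\<And>i. i \<in> set I \<Longrightarrow> TT' i = TT i" using that by (fastforce simp: A_def TT'_def)
    have ne: "I \<noteq> []" using that n_ge_2 by (auto simp: A_def)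
    have tl: "map2 TT' (tl I) xs = map2 TT (tl I) xs" for xs
      by (rule map_cong) (use le ne in \<open>auto dest!: set_zip_leftD dest: list.set_sel(2)\<close>)
    have I: "map2 TT' I xs = map2 TT I xs" for xs
      by (rule map_cong) (use le in \<open>auto dest: set_zip_leftD\<close>)
    have hd: "TT' (hd I) = TT (hd I)" using le ne by simp
    show ?thesis by (simp only: e_def tl I hd)
  qed
  have sum_A: "(\<Sum>I\<in>A. e TT' I) = Theta n br \<rho> m TT us"
    unfolding Theta_def A_def[symmetric] e_def[symmetric] by (rule sum.cong) (auto simp: eA)
  have TT'0: "TT' 0 = T" and TT'm: "TT' (m + 1) = S"
    by (simp_all add: TT'_def TT0)
  have map2_top: "map2 TT' ((replicate l 0)[p := m + 1]) xs = (map T xs)[p := S (xs ! p)]"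
    if "length xs = l" for l p xs
  proof (rule nth_equalityI)
    fix q assume "q < length (map2 TT' ((replicate l 0)[p := m + 1]) xs)"
    then have "q < l" using that by simp
    then show "map2 TT' ((replicate l 0)[p := m + 1]) xs ! q = (map T xs)[p := S (xs ! p)] ! q"
      using that by (cases "q = p") (simp_all add: TT'0 TT'm[simplified])
  qed (use that in simp)
  have map2_rep: "map2 TT' (replicate l 0) xs = map T xs" if "length xs = l" for l xs
    by (rule nth_equalityI) (use that in \<open>auto simp: TT'0\<close>)
  \<comment> \<open>The head of the tuple is the index of the outer map, so \<open>top 0\<close> puts \<open>S\<close> outside, and
      \<open>top (Suc j)\<close> puts \<open>S\<close> at the argument \<open>j\<close> of \<open>\<rho>\<close>.\<close>
  have e_0: "e TT' (top 0) = br ((map T us)[0 := S (us ! 0)]) - S (bracket_T n \<rho> T us)"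
  proof -
    have "top 0 = (m + 1) # replicate (n - 1) 0"
      using n_ge_2 by (cases n) (auto simp: top_def)
    then have "hd (top 0) = m + 1" "tl (top 0) = replicate (n - 1) 0" by simp_all
    moreover have "(\<Sum>k<n. signed (n - Suc k) (\<rho> (map2 TT' (replicate (n - 1) 0) (omit k us)) (us ! k)))
        = bracket_T n \<rho> T us"
      unfolding bracket_T_def by (rule sum.cong) (auto simp: map2_rep us)
    ultimately show ?thesis
      using map2_top[OF us, of 0] by (simp only: e_def TT'm) (simp add: top_def)
  qed
  have e_Suc: "e TT' (top (Suc j)) = br ((map T us)[Suc j := S (us ! Suc j)])
      - (\<Sum>k<n. ?G (skip k j) k)" if j: "j < n - 1" for j
  proof -
    have "top (Suc j) = 0 # (replicate (n - 1) 0)[j := m + 1]"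
      using n_ge_2 by (cases n) (auto simp: top_def)
    then have "hd (top (Suc j)) = 0" "tl (top (Suc j)) = (replicate (n - 1) 0)[j := m + 1]" by simp_all
    moreover have "T (\<Sum>k<n. signed (n - Suc k)
          (\<rho> (map2 TT' ((replicate (n - 1) 0)[j := m + 1]) (omit k us)) (us ! k)))
        = (\<Sum>k<n. ?G (skip k j) k)"
      unfolding linear_sum[OF T] linear_signed[OF T]
    proof (rule sum.cong[OF refl])
      fix k assume "k \<in> {..<n}"
      then have k: "k < n" by simp
      have "map2 TT' ((replicate (n - 1) 0)[j := m + 1]) (omit k us)
          = omit k ((map T us)[skip k j := S (us ! skip k j)])"
        using k j us by (simp only: map2_top length_omit omit_skip_update length_map nth_omit map_omit)
      then show "signed (n - Suc k)
          (T (\<rho> (map2 TT' ((replicate (n - 1) 0)[j := m + 1]) (omit k us)) (us ! k))) = ?G (skip k j) k"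
        by (simp only:)
    qed
    ultimately show ?thesis
      using map2_top[OF us, of "Suc j"] by (simp only: e_def TT'0) (simp add: top_def)
  qed
  have "(\<Sum>p<n. e TT' (top p)) = e TT' (top 0) + (\<Sum>j<n - 1. e TT' (top (Suc j)))"
    using n_ge_2 by (simp add: sum_lessThan_first)
  also have "\<dots> = br ((map T us)[0 := S (us ! 0)])
      + (\<Sum>j<n - 1. br ((map T us)[Suc j := S (us ! Suc j)]))
      - S (bracket_T n \<rho> T us) - (\<Sum>j<n - 1. \<Sum>k<n. ?G (skip k j) k)"
    by (simp add: e_0 e_Suc sum_subtractf)
  also have "br ((map T us)[0 := S (us ! 0)]) + (\<Sum>j<n - 1. br ((map T us)[Suc j := S (us ! Suc j)]))
      = (\<Sum>i<n. br ((map T us)[i := S (us ! i)]))"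
    using n_ge_2 by (simp add: sum_lessThan_first)
  also have "(\<Sum>j<n - 1. \<Sum>k<n. ?G (skip k j) k) = (\<Sum>k<n. \<Sum>i\<in>{..<n} - {k}. ?G i k)"
  proof (subst sum.swap, rule sum.cong[OF refl])
    fix k assume "k \<in> {..<n}"
    then show "(\<Sum>j<n - 1. ?G (skip k j) k) = (\<Sum>i\<in>{..<n} - {k}. ?G i k)"
      using sum_skip[of k n "\<lambda>i. ?G i k"] by simp
  qed
  also have "\<dots> = (\<Sum>i<n. \<Sum>k\<in>{..<n} - {i}. ?G i k)"
    using sum.swap_restrict[of "{..<n}" "{..<n}" "\<lambda>k i. ?G i k" "\<lambda>k i. i \<noteq> k"]
    by (simp add: set_diff_eq conj_commute eq_commute)
  also have "(\<Sum>i<n. br ((map T us)[i := S (us ! i)])) - S (bracket_T n \<rho> T us)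
        - (\<Sum>i<n. \<Sum>k\<in>{..<n} - {i}. ?G i k)
      = (\<Sum>i<n. signed (n - Suc i) (rho_T n br \<rho> T (omit i us) (S (us ! i))))
        - S (bracket_T n \<rho> T us)"
    by (simp add: signed_rho_T_omit[OF T us] sum_subtractf)
  also have "\<dots> = differential n br \<rho> T 1 f [U] u"
    by (simp only: differential_1[OF U] us_def S)
  finally have sum_top: "(\<Sum>I\<in>top ` {..<n}. e TT' I) = differential n br \<rho> T 1 f [U] u"
    by (simp add: sum.reindex[OF inj])
  show ?thesis
    unfolding rb_defect_def us_def[symmetric] TT'_def[symmetric] e_def[symmetric] comps
    using sum.union_disjoint[OF finA _ disj, of "e TT'"] sum_A sum_top by simp
qed

section \<open>Trivial cohomology classes\<close>

lemma zero_cochain: "(\<lambda>Us u. 0) \<in> cochains n sg sv m"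
  unfolding cochains_def alternating_multilinear_def
  using linear_zero_map[OF vector_space_V vector_space_g] by simp

lemma cochains_diff:
  assumes "f \<in> cochains n sg sv m" "g \<in> cochains n sg sv m"
  shows "(\<lambda>Us u. f Us u - g Us u) \<in> cochains n sg sv m"
  using assms unfolding cochains_def alternating_multilinear_def
  by (auto intro: linear_diff_map)

lemma differential_diff:
  assumes T: "Vector_Spaces.linear sv sg T" and m: "m \<ge> 1"
  shows "differential n br \<rho> T m (\<lambda>Us u. f Us u - g Us u) =
    (\<lambda>Us u. differential n br \<rho> T m f Us u - differential n br \<rho> T m g Us u)"
proof (intro ext)
  fix Us u
  show "differential n br \<rho> T m (\<lambda>Us u. f Us u - g Us u) Us u =
    differential n br \<rho> T m f Us u - differential n br \<rho> T m g Us u"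
  proof (cases "cochain_args n (m + 1) Us")
    case True
    then have len: "length (Us ! j) = n - 1" if "j < m" for j
      using that by (simp add: cochain_args_def)
    have len': "length (omit i (Us ! (m - 1)) @ [u]) = n - 1" if "i < n - 1" for i
      using that m n_ge_2 by (simp add: len)
    from True show ?thesis
      by (simp add: differential_def signed_diff sum_subtractf rho_T_diff[OF T len]
          rho_T_diff[OF T len'] cong: sum.cong_simp del: One_nat_def)
  qed (simp add: differential_def)
qed

lemma coboundaries_diff:
  assumes T: "Vector_Spaces.linear sv sg T" and m: "m \<ge> 2"
    and fg: "f \<in> coboundaries n sg br sv \<rho> T m" "g \<in> coboundaries n sg br sv \<rho> T m"
  shows "(\<lambda>Us u. f Us u - g Us u) \<in> coboundaries n sg br sv \<rho> T m"
proof -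
  obtain f' g' where f': "f' \<in> cochains n sg sv (m - 1)" "f = differential n br \<rho> T (m - 1) f'"
    and g': "g' \<in> cochains n sg sv (m - 1)" "g = differential n br \<rho> T (m - 1) g'"
    using fg m by (auto simp: coboundaries_def)
  have "(\<lambda>Us u. f Us u - g Us u) = differential n br \<rho> T (m - 1) (\<lambda>Us u. f' Us u - g' Us u)"
    using differential_diff[OF T, of "m - 1" f' g'] m f'(2) g'(2) by simp
  then show ?thesis using cochains_diff[OF f'(1) g'(1)] m by (auto simp: coboundaries_def)
qed

lemma zero_coboundary:
  assumes T: "Vector_Spaces.linear sv sg T" and m: "m \<ge> 2"
  shows "(\<lambda>Us u. 0) \<in> coboundaries n sg br sv \<rho> T m"
proof -
  have "differential n br \<rho> T (m - 1) (\<lambda>Us u. 0) \<in> coboundaries n sg br sv \<rho> T m"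
    using zero_cochain m by (simp add: coboundaries_def)
  from coboundaries_diff[OF T m this this] show ?thesis by simp
qed

lemma cohomology_class_trivial_iff:
  assumes T: "Vector_Spaces.linear sv sg T" and m: "m \<ge> 2"
  shows "cohomology_class n sg br sv \<rho> T m f = \<one>\<^bsub>cohomology_group n sg br sv \<rho> T m\<^esub>
    \<longleftrightarrow> f \<in> coboundaries n sg br sv \<rho> T m"
proof -
  let ?B = "coboundaries n sg br sv \<rho> T m"
  have "cohomology_class n sg br sv \<rho> T m f = (\<lambda>h Us u. h Us u + f Us u) ` ?B"
    by (auto simp: cohomology_class_def r_coset_def cocycle_group_def)
  moreover have "\<one>\<^bsub>cohomology_group n sg br sv \<rho> T m\<^esub> = ?B"
    by (simp add: cohomology_group_def FactGroup_def)
  moreover have "(\<lambda>h Us u. h Us u + f Us u) ` ?B = ?B \<longleftrightarrow> f \<in> ?B"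
  proof
    assume "(\<lambda>h Us u. h Us u + f Us u) ` ?B = ?B"
    moreover have "(\<lambda>Us u. 0 + f Us u) \<in> (\<lambda>h Us u. h Us u + f Us u) ` ?B"
      using zero_coboundary[OF T m] by (rule rev_image_eqI) simp
    ultimately show "f \<in> ?B" by simp
  next
    assume f: "f \<in> ?B"
    have neg: "(\<lambda>Us u. 0 - f Us u) \<in> ?B"
      by (rule coboundaries_diff[OF T m zero_coboundary[OF T m] f])
    show "(\<lambda>h Us u. h Us u + f Us u) ` ?B = ?B"
    proof (intro subset_antisym subsetI)
      fix g assume "g \<in> (\<lambda>h Us u. h Us u + f Us u) ` ?B"
      then obtain h where "h \<in> ?B" "g = (\<lambda>Us u. h Us u + f Us u)" by auto
      with coboundaries_diff[OF T m _ neg, of h] show "g \<in> ?B" by simp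
    next
      fix g assume "g \<in> ?B"
      then show "g \<in> (\<lambda>h Us u. h Us u + f Us u) ` ?B"
        by (rule rev_image_eqI[OF coboundaries_diff[OF T m _ f]]) simp
    qed
  qed
  ultimately show ?thesis by simp
qed

lemma cochains_1_iff:
  "f \<in> cochains n sg sv 1 \<longleftrightarrow> Vector_Spaces.linear sv sg (f []) \<and> (\<forall>Us u. Us \<noteq> [] \<longrightarrow> f Us u = 0)"
  by (auto simp: cochains_def cochain_args_def)

lemma differential_1_eq_as_2cochain_iff:
  "differential n br \<rho> T 1 f = as_2cochain n \<phi> \<longleftrightarrow>
    (\<forall>U u. length U = n - 1 \<longrightarrow> differential n br \<rho> T 1 f [U] u = \<phi> (U @ [u]))"
proof -
  have args: "cochain_args n 2 Us \<longleftrightarrow> (\<exists>U. Us = [U] \<and> length U = n - 1)" for Us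
    by (auto simp: cochain_args_def length_Suc_conv)
  have off: "differential n br \<rho> T 1 f Us u = 0" if "\<not> cochain_args n 2 Us" for Us u
    using that by (simp add: differential_def numeral_2_eq_2)
  show ?thesis
  proof (intro iffI allI impI ext)
    fix U :: "'v list" and u assume "differential n br \<rho> T 1 f = as_2cochain n \<phi>" "length U = n - 1"
    then show "differential n br \<rho> T 1 f [U] u = \<phi> (U @ [u])"
      by (simp add: as_2cochain_def args)
  next
    fix Us u
    assume "\<forall>U u. length U = n - 1 \<longrightarrow> differential n br \<rho> T 1 f [U] u = \<phi> (U @ [u])"
    then show "differential n br \<rho> T 1 f Us u = as_2cochain n \<phi> Us u"
      by (cases "cochain_args n 2 Us") (auto simp: as_2cochain_def off[simplified] args)
  qed
qed

section \<open>Extendability\<close>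

text \<open>The condition on the extension \<open>S\<close> is \<open>\<Theta>\<^sub>m + dS = 0\<close>, so that \<open>\<Theta>\<^sub>m\<close> is the differential of
  \<open>- S\<close>.\<close>

lemma extendable_iff:
  assumes T: "Vector_Spaces.linear sv sg T" and def: "deformation n sg br sv \<rho> T m TT"
  shows "extendable n sg br sv \<rho> T m TT \<longleftrightarrow>
    as_2cochain n (Theta n br \<rho> m TT) \<in> coboundaries n sg br sv \<rho> T 2"
proof -
  have def': "\<And>i. i \<le> m \<Longrightarrow> Vector_Spaces.linear sv sg (TT i)" "TT 0 = T"
    "\<And>us K. length us = n \<Longrightarrow> K \<le> m \<Longrightarrow> rb_defect n br \<rho> TT K us = 0"
    using def unfolding deformation_iff by auto
  have last: "(\<forall>us. length us = n \<longrightarrow> P us) \<longleftrightarrow> (\<forall>U u. length U = n - 1 \<longrightarrow> P (U @ [u]))"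
    for P :: "'v list \<Rightarrow> bool"
  proof (intro iffI allI impI)
    fix us :: "'v list"
    assume "\<forall>U u. length U = n - 1 \<longrightarrow> P (U @ [u])" "length us = n"
    then show "P us" using n_ge_2 by (cases us rule: rev_cases) auto
  qed (use n_ge_2 in auto)
  have step: "deformation n sg br sv \<rho> T (m + 1) (TT(m + 1 := S)) \<longleftrightarrow>
      (\<forall>U u. length U = n - 1 \<longrightarrow>
        Theta n br \<rho> m TT (U @ [u]) + differential n br \<rho> T 1 f [U] u = 0)"
    if S: "Vector_Spaces.linear sv sg S" "f [] = S" for S f
  proof -
    have low: "rb_defect n br \<rho> (TT(m + 1 := S)) K us = 0" if "length us = n" "K \<le> m" for K us
      using rb_defect_cong[of K "TT(m + 1 := S)" TT] that def'(3) n_ge_2 by simp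
    have "deformation n sg br sv \<rho> T (m + 1) (TT(m + 1 := S)) \<longleftrightarrow>
        (\<forall>us. length us = n \<longrightarrow> rb_defect n br \<rho> (TT(m + 1 := S)) (m + 1) us = 0)"
      unfolding deformation_iff using S(1) def'(1,2) low by (auto simp: le_Suc_eq)
    also have "\<dots> \<longleftrightarrow> (\<forall>U u. length U = n - 1 \<longrightarrow>
        rb_defect n br \<rho> (TT(m + 1 := S)) (m + 1) (U @ [u]) = 0)"
      by (rule last)
    finally show ?thesis using rb_defect_top[where f = f and TT = TT, OF T S(2) def'(2)] by simp
  qed
  have neg: "differential n br \<rho> T 1 (\<lambda>Us u. 0 - f Us u) [U] u = - differential n br \<rho> T 1 f [U] u"
    for f U u
    using differential_diff[OF T, of 1 "\<lambda>Us u. 0" "\<lambda>Us u. 0"]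
    by (simp only: differential_diff[OF T order_refl] diff_self) simp
  show ?thesis
  proof
    assume "extendable n sg br sv \<rho> T m TT"
    then obtain S where S: "Vector_Spaces.linear sv sg S"
      "deformation n sg br sv \<rho> T (m + 1) (TT(m + 1 := S))"
      by (auto simp: extendable_def)
    define f where "f Us u = (if Us = [] then S u else 0)" for Us :: "'v list list" and u
    have fS: "f [] = S" by (simp add: f_def fun_eq_iff)
    then have f: "f \<in> cochains n sg sv 1"
      using S(1) unfolding cochains_1_iff by (simp add: f_def)
    let ?f = "\<lambda>Us u. 0 - f Us u"
    have "?f \<in> cochains n sg sv 1" using cochains_diff[OF zero_cochain f] .
    moreover have "differential n br \<rho> T 1 ?f = as_2cochain n (Theta n br \<rho> m TT)"
      unfolding differential_1_eq_as_2cochain_iff neg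
      using step[where f = f, OF S(1) fS] S(2) by (simp add: add_eq_0_iff2)
    ultimately show "as_2cochain n (Theta n br \<rho> m TT) \<in> coboundaries n sg br sv \<rho> T 2"
      by (auto simp: coboundaries_def intro!: rev_image_eqI)
  next
    assume "as_2cochain n (Theta n br \<rho> m TT) \<in> coboundaries n sg br sv \<rho> T 2"
    then obtain f where f: "f \<in> cochains n sg sv 1"
      "differential n br \<rho> T 1 f = as_2cochain n (Theta n br \<rho> m TT)"
      by (auto simp: coboundaries_def)
    let ?f = "\<lambda>Us u. 0 - f Us u"
    have "?f \<in> cochains n sg sv 1" using cochains_diff[OF zero_cochain f(1)] .
    then have S: "Vector_Spaces.linear sv sg (?f [])" unfolding cochains_1_iff by blast
    have "deformation n sg br sv \<rho> T (m + 1) (TT(m + 1 := ?f []))"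
      unfolding step[where f = ?f, OF S refl] neg
      using f(2) unfolding differential_1_eq_as_2cochain_iff by simp
    with S show "extendable n sg br sv \<rho> T m TT" by (auto simp: extendable_def)
  qed
qed

end

theorem theorem5p6:
  fixes sg :: "'k::{alg_closed_field, field_char_0} \<Rightarrow> 'g::ab_group_add \<Rightarrow> 'g"
    and sv :: "'k \<Rightarrow> 'v::ab_group_add \<Rightarrow> 'v"
    and br :: "'g list \<Rightarrow> 'g"
    and \<rho> :: "'g list \<Rightarrow> 'v \<Rightarrow> 'v"
    and T :: "'v \<Rightarrow> 'g"
    and TT :: "nat \<Rightarrow> 'v \<Rightarrow> 'g"
    and n m :: nat
  assumes "n_LieRep_pair n sg br sv \<rho>"
    and "relative_Rota_Baxter n sg br sv \<rho> T"
    and "deformation n sg br sv \<rho> T m TT"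
  shows "extendable n sg br sv \<rho> T m TT \<longleftrightarrow>
    cohomology_class n sg br sv \<rho> T 2 (as_2cochain n (Theta n br \<rho> m TT))
      = \<one>\<^bsub>cohomology_group n sg br sv \<rho> T 2\<^esub>"
proof -
  interpret n_LieRep_pair n sg br sv \<rho> by fact
  have T: "Vector_Spaces.linear sv sg T"
    using assms(2) by (simp add: relative_Rota_Baxter_def)
  show ?thesis
    using extendable_iff[OF T assms(3)] cohomology_class_trivial_iff[OF T order_refl] by simp
qed

end
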